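(* Let $6 \le p \le q$ and let $D$ be a strong orientation of $K(3,p,q)$ with diameter two, with parts $V_1=\{x_1,x_2,x_3\}$, $V_2$ ($|V_2|=p$), $V_3$ ($|V_3|=q$). If exactly six of the eight sets $V_2^A$ ($A \subseteq \{1,2,3\}$) are nonempty, then $q \le \binom{p-2}{\lfloor \frac{p-2}{2} \rfloor}$.
   Context: $K(3,p,q)$ is the complete tripartite graph with parts $V_1=\{x_1,x_2,x_3\}$, $V_2$ of size $p$, $V_3$ of size $q$. A strong orientation is an orientation of all edges making the digraph strongly connected; its diameter is the maximum directed distance between ordered pairs of vertices. Write $u\to v$ if the edge $uv$ is oriented from $u$ to $v$. For $A \subseteq [3]=\{1,2,3\}$, let $N_D^A$ be the set of vertices $w$ such that $x_i \to w$ for all $i \in A$ and $w \to x_j$ for all $j \in [3]\setminus A$, and $V_2^A = V_2 \cap N_D^A$. The eight sets $V_2^A$ partition $V_2$. *)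

theory Defs
  imports "Graph_Theory.Graph_Theory"
begin

text \<open>
  As in the entry Graph_Theory, an undirected simple graph is a symmetric loop-free digraph
  (\<open>pair_graph\<close>); the edge \<open>uv\<close> is the pair of arcs \<open>(u, v)\<close> and \<open>(v, u)\<close>.
\<close>

text \<open>\<open>G\<close> is the complete tripartite graph \<open>K(l, m, n)\<close> with parts \<open>U\<close>, \<open>V\<close>, \<open>W\<close> of these sizes.\<close>

definition complete_tripartite ::
    "nat \<Rightarrow> nat \<Rightarrow> nat \<Rightarrow> 'a set \<Rightarrow> 'a set \<Rightarrow> 'a set \<Rightarrow> 'a pair_pre_digraph \<Rightarrow> bool" where
  "complete_tripartite l m n U V W G \<longleftrightarrow>
     pair_graph G \<and> pverts G = U \<union> V \<union> W \<and>
     U \<inter> V = {} \<and> U \<inter> W = {} \<and> V \<inter> W = {} \<and>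
     card U = l \<and> card V = m \<and> card W = n \<and>
     parcs G = U \<times> V \<union> V \<times> U \<union> U \<times> W \<union> W \<times> U \<union> V \<times> W \<union> W \<times> V"

definition orientation :: "'a pair_pre_digraph \<Rightarrow> 'a pair_pre_digraph \<Rightarrow> bool" where
  "orientation G D \<longleftrightarrow>
     pverts D = pverts G \<and> parcs D \<subseteq> parcs G \<and>
     (\<forall>(u, v) \<in> parcs G. (u, v) \<in> parcs D \<longleftrightarrow> (v, u) \<notin> parcs D)"

text \<open>
  The directed distance is the library's shortest-path cost with all arc weights equal to 1; it is
  \<open>\<infinity>\<close> if there is no walk. On a finite nonempty vertex set the supremum is a maximum.
\<close>

definition directed_dist :: "('a, 'b) pre_digraph \<Rightarrow> 'a \<Rightarrow> 'a \<Rightarrow> ereal" where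
  "directed_dist D u v = wf_digraph.\<mu> D (\<lambda>_. 1) u v"

definition diameter :: "('a, 'b) pre_digraph \<Rightarrow> ereal" where
  "diameter D = (SUP (u, v) \<in> verts D \<times> verts D. directed_dist D u v)"

definition N_set :: "('a, 'b) pre_digraph \<Rightarrow> (nat \<Rightarrow> 'a) \<Rightarrow> nat set \<Rightarrow> 'a set" where
  "N_set D x A =
     {w \<in> verts D. (\<forall>i \<in> A. x i \<rightarrow>\<^bsub>D\<^esub> w) \<and> (\<forall>j \<in> {1, 2, 3} - A. w \<rightarrow>\<^bsub>D\<^esub> x j)}"

end

theory Submission
  imports Defs
begin

text \<open>
  Colour a vertex \<open>w\<close> outside \<open>V1\<close> by its in-neighbourhood in \<open>V1\<close>, read as a subset of \<open>{1, 2, 3}\<close>.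
  Distance two between \<open>V2\<close> and \<open>V3\<close> forbids a common colour and forces the direction of every edge
  whose colours are comparable. As \<open>V2\<close> uses six colours, \<open>V3\<close> uses at most two. Vertices of \<open>V3\<close> of one
  colour \<open>B\<close> differ only in their out-neighbourhoods among the vertices of \<open>V2\<close> whose colour is
  incomparable to \<open>B\<close>, where they form an antichain, so Sperner's theorem bounds each colour class.

  If \<open>{}\<close> and \<open>{1, 2, 3}\<close> both occur in \<open>V2\<close>, then distance two between \<open>V1\<close> and \<open>V2\<close> makes the two
  colours of \<open>V3\<close> complementary, each is comparable to four colours of \<open>V2\<close>, and \<open>q\<close> is at most twice
  the middle binomial coefficient of \<open>p - 4\<close>. Otherwise a colour of \<open>V3\<close> is \<open>{}\<close> or \<open>{1, 2, 3}\<close>,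
  its class has at most one vertex, and any other colour is comparable to at least three colours
  of \<open>V2\<close>.
\<close>

section \<open>Central binomial coefficients and Sperner's theorem\<close>

abbreviation central_binomial :: "nat \<Rightarrow> nat" where
  "central_binomial n \<equiv> n choose (n div 2)"

text \<open>Pascal's rule: the summand beside the central coefficient is positive once
  \<open>n\<close> is at least 1. The gain of 1 later absorbs a colour class with a single
  vertex.\<close>

lemma central_binomial_Suc:
  assumes "n \<ge> 1"
  shows "central_binomial n + 1 \<le> central_binomial (Suc n)"
proof -
  have "n choose Suc (n div 2) \<ge> 1"
    using assms by (simp add: Suc_le_eq zero_less_binomial_iff)
  then have "central_binomial n + 1 \<le> Suc n choose Suc (n div 2)"
    by simp
  also have "\<dots> \<le> central_binomial (Suc n)"
    by (rule binomial_maximum)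
  finally show ?thesis .
qed

lemma central_binomial_mono: "m \<le> n \<Longrightarrow> central_binomial m \<le> central_binomial n"
proof (induction n rule: dec_induct)
  case (step n)
  then show ?case
    using central_binomial_Suc[of n] by (cases n) auto
qed simp

text \<open>Pascal's rule twice: both summands of the coefficient in row \<open>n + 2\<close> are at
  least \<open>n choose k\<close>. This absorbs two colour classes of equal bound.\<close>

lemma central_binomial_Suc_Suc: "2 * central_binomial n \<le> central_binomial (Suc (Suc n))"
proof -
  define k where "k = n div 2"
  have "n choose k \<le> Suc n choose k"
    by (cases k) auto
  then have "2 * (n choose k) \<le> Suc (Suc n) choose Suc k"
    by simp
  also have "\<dots> \<le> central_binomial (Suc (Suc n))"
    by (rule binomial_maximum)
  finally show ?thesis
    by (simp only: k_def)
qed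

text \<open>
  By induction on \<open>S\<close>: averaging the inequality for \<open>S - {x}\<close> and the members that avoid \<open>x\<close> over all
  \<open>x \<in> S\<close> gives the inequality for \<open>S\<close>.
\<close>

lemma lym_inequality:
  assumes "finite S" and "F \<subseteq> Pow S"
    and "\<And>A B. A \<in> F \<Longrightarrow> B \<in> F \<Longrightarrow> A \<subseteq> B \<Longrightarrow> A = B"
  shows "(\<Sum>A\<in>F. 1 / real (card S choose card A)) \<le> 1"
  using assms
proof (induction "card S" arbitrary: S F)
  case 0
  then have "F \<subseteq> {{}}"
    by auto
  then have "F = {} \<or> F = {{}}"
    by blast
  then show ?case
    by auto
next
  case (Suc n)
  show ?case
  proof (cases "S \<in> F")
    case True
    then have "F = {S}"
      using Suc.prems by blast
    then show ?thesis
      by simp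
  next
    case False
    have "finite F"
      using Suc.prems by (meson finite_Pow_iff finite_subset)
    \<comment> \<open>The absorption identity turns the weight of \<open>A\<close> in
      \<open>S\<close> into its weight in \<open>S\<close> minus a point, once for each of the
      points outside \<open>A\<close>.\<close>
    have card_diff: "card (S - A) * (Suc n choose card A) = Suc n * (n choose card A)"
      and nz: "n choose card A > 0" if "A \<in> F" for A
    proof -
      have "A \<subset> S"
        using that False Suc.prems by blast
      then have less: "card A < card S"
        using Suc.prems(1) by (simp add: psubset_card_mono)
      have "card (S - A) = Suc n - card A"
        using \<open>A \<subset> S\<close> Suc.hyps(2) Suc.prems(1) card_Diff_subset[of A S] finite_subset[of A S] by auto
      then show "card (S - A) * (Suc n choose card A) = Suc n * (n choose card A)"
        using binomial_absorb_comp[of "Suc n" "card A"] by simp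
      show "n choose card A > 0"
        using less Suc by simp
    qed
    have "real (Suc n) * (\<Sum>A\<in>F. 1 / real (Suc n choose card A))
        = (\<Sum>A\<in>F. real (card (S - A)) / real (n choose card A))"
      unfolding sum_distrib_left
    proof (rule sum.cong[OF refl])
      fix A assume "A \<in> F"
      have "Suc n choose card A > 0"
        using nz[OF \<open>A \<in> F\<close>] binomial_right_mono[of n "Suc n" "card A"] by linarith
      moreover have "real (card (S - A)) * real (Suc n choose card A) = real (Suc n) * real (n choose card A)"
        using card_diff[OF \<open>A \<in> F\<close>] by (metis of_nat_mult)
      ultimately show "real (Suc n) * (1 / real (Suc n choose card A))
          = real (card (S - A)) / real (n choose card A)"
        using nz[OF \<open>A \<in> F\<close>] by (simp add: field_simps del: of_nat_Suc binomial_Suc_Suc)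
    qed
    also have "\<dots> = (\<Sum>A\<in>F. \<Sum>x\<in>{x \<in> S. x \<notin> A}. 1 / real (n choose card A))"
      by (simp add: set_diff_eq)
    also have "\<dots> = (\<Sum>x\<in>S. \<Sum>A\<in>{A \<in> F. x \<notin> A}. 1 / real (n choose card A))"
      using \<open>finite F\<close> \<open>finite S\<close> by (rule sum.swap_restrict)
    also have "\<dots> \<le> (\<Sum>x\<in>S. 1)"
    proof (rule sum_mono)
      fix x assume "x \<in> S"
      then have n: "n = card (S - {x})"
        using Suc by simp
      show "(\<Sum>A\<in>{A \<in> F. x \<notin> A}. 1 / real (n choose card A)) \<le> 1"
        unfolding n
      proof (rule Suc.hyps(1))
        show "{A \<in> F. x \<notin> A} \<subseteq> Pow (S - {x})"
          using Suc.prems(2) by blast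
      qed (use Suc.prems n in auto)
    qed
    also have "\<dots> = real (Suc n)"
      using Suc by simp
    finally show ?thesis
      using Suc by (simp del: of_nat_Suc)
  qed
qed

theorem sperner:
  assumes "finite S" and "F \<subseteq> Pow S"
    and "\<And>A B. A \<in> F \<Longrightarrow> B \<in> F \<Longrightarrow> A \<subseteq> B \<Longrightarrow> A = B"
  shows "card F \<le> central_binomial (card S)"
proof -
  let ?c = "central_binomial (card S)"
  have "real (card F) / real ?c = (\<Sum>A\<in>F. 1 / real ?c)"
    by simp
  also have "\<dots> \<le> (\<Sum>A\<in>F. 1 / real (card S choose card A))"
  proof (rule sum_mono)
    fix A assume "A \<in> F"
    then have "card S choose card A > 0"
      using assms by (auto intro!: card_mono simp: zero_less_binomial_iff)
    then show "1 / real ?c \<le> 1 / real (card S choose card A)"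
      using binomial_maximum[of "card S" "card A"] by (intro divide_left_mono) auto
  qed
  also have "\<dots> \<le> 1"
    using assms by (rule lym_inequality)
  finally show ?thesis
    by (simp add: divide_le_eq zero_less_binomial_iff split: if_splits)
qed

section \<open>Colours\<close>

text \<open>Supersets of \<open>B\<close> correspond to subsets of \<open>S - B\<close>, and only
  \<open>B\<close> itself lies both above and below \<open>B\<close>.\<close>

lemma card_comparable:
  assumes "finite S" and "B \<subseteq> S"
  shows "card {A \<in> Pow S. A \<subseteq> B \<or> B \<subseteq> A} = 2 ^ card B + 2 ^ (card S - card B) - 1"
proof -
  let ?up = "(\<union>) B ` Pow (S - B)"
  have [simp]: "finite B"
    using assms by (rule finite_subset[rotated])
  have "card ?up = card (Pow (S - B))"
    by (intro card_image inj_onI) blast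
  then have up: "card ?up = 2 ^ (card S - card B)"
    using assms by (simp add: card_Pow card_Diff_subset)
  have "{A \<in> Pow S. A \<subseteq> B \<or> B \<subseteq> A} = Pow B \<union> ?up"
  proof (intro equalityI subsetI)
    fix A assume "A \<in> {A \<in> Pow S. A \<subseteq> B \<or> B \<subseteq> A}"
    then show "A \<in> Pow B \<union> ?up"
      by (auto intro!: image_eqI[of A _ "A - B"])
  qed (use assms in auto)
  moreover have "card (Pow B \<inter> ?up) = 1"
  proof -
    have "Pow B \<inter> ?up = {B}"
      by auto
    then show ?thesis
      by simp
  qed
  ultimately show ?thesis
    using card_Un_Int[of "Pow B" ?up] up assms by (simp add: card_Pow)
qed

text \<open>On vertices of \<open>V\<close> whose colour is comparable to \<open>B\<close>, the set
  \<open>N w\<close> is the same for all \<open>w\<close> of colour \<open>B\<close>. Hence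
  \<open>antichain\<close> passes to the traces of \<open>N w\<close> on the remaining vertices, and
  Sperner's theorem applies there.\<close>

lemma card_colour_class:
  assumes "finite V"
    and forced_out: "\<And>u w. u \<in> V \<Longrightarrow> w \<in> W \<Longrightarrow> t u \<subseteq> t w \<Longrightarrow> u \<in> N w"
    and forced_in: "\<And>u w. u \<in> V \<Longrightarrow> w \<in> W \<Longrightarrow> t w \<subseteq> t u \<Longrightarrow> u \<notin> N w"
    and antichain: "\<And>w w'. w \<in> W \<Longrightarrow> w' \<in> W \<Longrightarrow> t w = t w' \<Longrightarrow> V \<inter> N w \<subseteq> N w' \<Longrightarrow> w = w'"
  shows "card {w \<in> W. t w = B} \<le> central_binomial (card {u \<in> V. \<not> (t u \<subseteq> B \<or> B \<subseteq> t u)})"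
proof -
  define F where "F = {u \<in> V. \<not> (t u \<subseteq> B \<or> B \<subseteq> t u)}"
  define K where "K = {w \<in> W. t w = B}"
  have eq: "w = w'" if "w \<in> K" "w' \<in> K" "N w \<inter> F \<subseteq> N w' \<inter> F" for w w'
  proof (rule antichain)
    show K: "w \<in> W" "w' \<in> W" "t w = t w'"
      using that by (simp_all add: K_def)
    show "V \<inter> N w \<subseteq> N w'"
    proof
      fix u assume u: "u \<in> V \<inter> N w"
      then have "\<not> t w \<subseteq> t u"
        using forced_in[of u w] K by blast
      then show "u \<in> N w'"
        using u that forced_out[of u w'] K by (cases "t u \<subseteq> B") (auto simp: F_def K_def)
    qed
  qed
  have "inj_on (\<lambda>w. N w \<inter> F) K"
    by (intro inj_onI eq) simp_all
  then have "card K = card ((\<lambda>w. N w \<inter> F) ` K)"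
    by (simp add: card_image)
  also have "\<dots> \<le> central_binomial (card F)"
  proof (rule sperner)
    show "A = A'" if "A \<in> (\<lambda>w. N w \<inter> F) ` K" "A' \<in> (\<lambda>w. N w \<inter> F) ` K" "A \<subseteq> A'" for A A'
      using that eq by blast
  qed (use \<open>finite V\<close> in \<open>auto simp: F_def\<close>)
  finally show ?thesis
    by (simp add: F_def K_def)
qed

text \<open>Each comparable colour in use accounts for at least one vertex of
  \<open>V\<close>.\<close>

lemma card_incomparable:
  assumes "finite V" and "k \<le> card {A \<in> t ` V. A \<subseteq> B \<or> B \<subseteq> A}"
  shows "card {u \<in> V. \<not> (t u \<subseteq> B \<or> B \<subseteq> t u)} \<le> card V - k"
proof -
  let ?C = "{u \<in> V. t u \<subseteq> B \<or> B \<subseteq> t u}"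
  have "{A \<in> t ` V. A \<subseteq> B \<or> B \<subseteq> A} = t ` ?C"
    by blast
  then have "k \<le> card ?C"
    using assms card_image_le[of ?C t] by simp
  moreover have "{u \<in> V. \<not> (t u \<subseteq> B \<or> B \<subseteq> t u)} = V - ?C"
    by blast
  ultimately show ?thesis
    using \<open>finite V\<close> by (simp add: card_Diff_subset)
qed

text \<open>The combinatorial core, free of digraphs: \<open>V\<close> and \<open>W\<close> stand
  for \<open>V2\<close> and \<open>V3\<close>, and \<open>N w\<close> for the out-neighbourhood of
  \<open>w\<close>. \<open>cover\<close> and \<open>cocover\<close> record distance two between
  \<open>V1\<close> and \<open>V2\<close>, in both directions.\<close>

lemma card_le_if_six_colours:
  fixes t :: "'a \<Rightarrow> nat set"
  assumes fin: "finite V" "finite W" and "6 \<le> card V"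
    and t: "\<And>v. t v \<subseteq> {1, 2, 3}" and six: "card (t ` V) = 6"
    and forced_out: "\<And>u w. u \<in> V \<Longrightarrow> w \<in> W \<Longrightarrow> t u \<subseteq> t w \<Longrightarrow> u \<in> N w"
    and forced_in: "\<And>u w. u \<in> V \<Longrightarrow> w \<in> W \<Longrightarrow> t w \<subseteq> t u \<Longrightarrow> u \<notin> N w"
    and antichain: "\<And>w w'. w \<in> W \<Longrightarrow> w' \<in> W \<Longrightarrow> t w = t w' \<Longrightarrow> V \<inter> N w \<subseteq> N w' \<Longrightarrow> w = w'"
    and cover: "\<And>u i. u \<in> V \<Longrightarrow> i \<in> {1, 2, 3} - t u \<Longrightarrow> \<exists>w\<in>W. i \<in> t w"
    and cocover: "\<And>u i. u \<in> V \<Longrightarrow> i \<in> t u \<Longrightarrow> \<exists>w\<in>W. i \<notin> t w"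
  shows "card W \<le> central_binomial (card V - 2)"
proof -
  define n where "n = card V - 4"
  have n: "n \<ge> 2" "card V - 2 = Suc (Suc n)" "card V - 3 = Suc n"
    using \<open>6 \<le> card V\<close> by (auto simp: n_def)
  let ?S = "Pow {1, 2, 3 :: nat}"
  let ?class = "\<lambda>B. {w \<in> W. t w = B}"
  have tS: "t ` V \<subseteq> ?S"
    using t by blast
  then have "card (?S - t ` V) = 2"
    by (simp add: card_Diff_subset fin six card_Pow)
  then obtain B C where BC: "?S - t ` V = {B, C}" "B \<noteq> C"
    by (auto simp: card_2_iff)
  \<comment> \<open>For a colour shared by \<open>u\<close> and \<open>w\<close>, the two forcing
    hypotheses would contradict each other.\<close>
  have colours: "t w \<in> {B, C}" if "w \<in> W" for w
  proof -
    have "t w \<notin> t ` V"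
      using that forced_in[of _ w] forced_out[of _ w] by auto
    then show ?thesis
      using t[of w] BC(1) by blast
  qed
  then have "card W \<le> card (?class B \<union> ?class C)"
    using fin by (intro card_mono) auto
  also have "\<dots> \<le> card (?class B) + card (?class C)"
    by (rule card_Un_le)
  finally have sum: "card W \<le> card (?class B) + card (?class C)" .
  have class_bound: "card (?class A) \<le> central_binomial (card {u \<in> V. \<not> (t u \<subseteq> A \<or> A \<subseteq> t u)})" for A
    by (rule card_colour_class[OF fin(1), where N = N]) (fact forced_out forced_in antichain)+
  have class_le: "card (?class A) \<le> central_binomial (card V - k)"
    if "k \<le> card {A' \<in> t ` V. A' \<subseteq> A \<or> A \<subseteq> A'}" for A k
    using class_bound central_binomial_mono[OF card_incomparable[OF fin(1) that]] by (rule order_trans)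
  \<comment> \<open>A subset with one or two elements is comparable to 2 + 4 - 1 = 5 colours.
    \<open>E\<close> contains those among them that \<open>V\<close> may miss.\<close>
  have comparable: "5 - card E \<le> card {A' \<in> t ` V. A' \<subseteq> A \<or> A \<subseteq> A'}"
    if "A \<in> ?S" "A \<noteq> {}" "A \<noteq> {1, 2, 3}" "finite E"
      "\<And>A'. A' \<in> {B, C} \<Longrightarrow> A' \<subseteq> A \<or> A \<subseteq> A' \<Longrightarrow> A' \<in> E" for A E
  proof -
    let ?P = "{A' \<in> ?S. A' \<subseteq> A \<or> A \<subseteq> A'}"
    have "A \<subset> {1, 2, 3}" "finite A"
      using that finite_subset[of A] by auto
    then have "card A = 1 \<or> card A = 2"
      using that(2) psubset_card_mono[of "{1, 2, 3}" A] card_gt_0_iff[of A] by auto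
    then have "card ?P = 5"
      using card_comparable[of "{1, 2, 3}" A] that by auto
    then have "5 - card E \<le> card (?P - E)"
      using that diff_card_le_card_Diff[of E ?P] by simp
    also have "\<dots> \<le> card {A' \<in> t ` V. A' \<subseteq> A \<or> A \<subseteq> A'}"
      using that(5) BC(1) fin by (intro card_mono) auto
    finally show ?thesis .
  qed
  \<comment> \<open>An extreme colour is comparable to every colour, so Sperner's theorem is applied
    to the empty set.\<close>
  have class_extreme: "card (?class A) \<le> 1" if "A = {} \<or> A = {1, 2, 3}" for A
  proof -
    have no_free: "{u \<in> V. \<not> (t u \<subseteq> A \<or> A \<subseteq> t u)} = {}"
      using that t by blast
    show ?thesis
      using class_bound[of A] unfolding no_free by simp
  qed
  have class_other: "card (?class A) \<le> central_binomial (Suc n)" if "A \<in> {B, C}" for A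
  proof (cases "A = {} \<or> A = {1, 2, 3}")
    case True
    have "1 \<le> central_binomial (Suc n)"
      by (simp add: Suc_le_eq zero_less_binomial_iff)
    then show ?thesis
      using class_extreme[OF True] by (rule order_trans[rotated])
  next
    case False
    have "A \<in> ?S"
      using that BC(1) by blast
    then have "3 \<le> card {A' \<in> t ` V. A' \<subseteq> A \<or> A \<subseteq> A'}"
      using comparable[of A "{B, C}"] False BC(2) by simp
    then have "card (?class A) \<le> central_binomial (card V - 3)"
      by (rule class_le)
    then show ?thesis
      by (simp only: n(3))
  qed
  have step: "central_binomial (Suc n) + 1 \<le> central_binomial (Suc (Suc n))"
    by (rule central_binomial_Suc) simp
  show ?thesis
  proof (cases "\<exists>A\<in>{B, C}. A = {} \<or> A = {1, 2, 3}")
    case True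
    then have "card (?class B) \<le> 1 \<or> card (?class C) \<le> 1"
      using class_extreme by blast
    then have "card W \<le> central_binomial (Suc n) + 1"
      using sum class_other[OF insertI1] class_other[OF insertI2, OF singletonI] by linarith
    then show ?thesis
      using step n(2) by simp
  next
    case False
    have present: "A \<in> t ` V" if "A \<in> ?S" "A \<notin> {B, C}" for A
      using that BC(1) by blast
    have "{} \<in> t ` V" "{1, 2, 3} \<in> t ` V"
      using False by (auto intro!: present)
    then obtain u v where u: "u \<in> V" "t u = {}" and v: "v \<in> V" "t v = {1, 2, 3}"
      by (metis imageE)
    \<comment> \<open>Applied at vertices of colour \<open>{}\<close> and \<open>{1, 2, 3}\<close>,
      \<open>cover\<close> and \<open>cocover\<close> make \<open>B\<close> and \<open>C\<close>
      complements.\<close>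
    have cov: "i \<in> B \<or> i \<in> C" and cocov: "i \<notin> B \<or> i \<notin> C" if i: "i \<in> {1, 2, 3}" for i
    proof -
      obtain w where "w \<in> W" "i \<in> t w"
        using cover[OF u(1)] u(2) i by blast
      then show "i \<in> B \<or> i \<in> C"
        using colours[of w] by blast
      obtain w' where "w' \<in> W" "i \<notin> t w'"
        using cocover[OF v(1)] v(2) i by blast
      then show "i \<notin> B \<or> i \<notin> C"
        using colours[of w'] by blast
    qed
    have "B \<in> ?S" "C \<in> ?S"
      using BC(1) by blast+
    then have "B \<union> C = {1, 2, 3}" "B \<inter> C = {}"
      using cov cocov by blast+
    then have incomp: "\<not> B \<subseteq> C" "\<not> C \<subseteq> B"
      using False by blast+
    have "card (?class A) \<le> central_binomial n" if "A \<in> {B, C}" for A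
    proof -
      have "A \<in> ?S"
        using that BC(1) by blast
      \<comment> \<open>Complementary colours other than the extreme ones are incomparable, so of
        the five colours comparable to \<open>A\<close> only \<open>A\<close> itself is missing from
        \<open>V\<close>.\<close>
      then have "4 \<le> card {A' \<in> t ` V. A' \<subseteq> A \<or> A \<subseteq> A'}"
        using comparable[of A "{A}"] False that incomp by auto
      then have "card (?class A) \<le> central_binomial (card V - 4)"
        by (rule class_le)
      then show ?thesis
        by (simp only: n_def)
    qed
    from this[of B] this[of C] sum have "card W \<le> 2 * central_binomial n"
      by simp
    then show ?thesis
      using central_binomial_Suc_Suc[of n] n(2) by simp
  qed
qed

section \<open>Orientations of diameter two\<close>

lemma walk_if_directed_dist_le_2:
  assumes "pair_wf_digraph D" and "directed_dist (with_proj D) u v \<le> 2" and "u \<noteq> v"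
  shows "(u, v) \<in> parcs D \<or> (\<exists>z. (u, z) \<in> parcs D \<and> (z, v) \<in> parcs D)"
proof -
  interpret pair_wf_digraph D
    by fact
  \<comment> \<open>A strict bound on the infimum yields an actual walk of cost below 3, and costs
    are lengths.\<close>
  have "\<mu> (\<lambda>_. 1) u v < 3"
    using assms(2) by (simp add: directed_dist_def order_le_less_trans)
  then obtain es where es: "awalk u es v" "awalk_cost (\<lambda>_. 1) es < 3"
    unfolding \<mu>_def INF_less_iff by auto
  have "awalk_cost (\<lambda>_. 1) es = length es"
    by (simp add: awalk_cost_def sum_list_triv)
  with es have "length es < 3"
    by simp
  then consider "es = []" | e where "es = [e]" | e e' where "es = [e, e']"
    \<comment> \<open>The rule is borrowed only for its split into lists of length 0, 1 and at least
      2.\<close>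
    by (cases es rule: remdups_adj.cases) auto
  then show ?thesis
    using es(1) \<open>u \<noteq> v\<close> by cases (auto simp: awalk_simps)
qed

theorem theorem4p22:
  fixes p q :: nat
    and G D :: "'a pair_pre_digraph"
    and x :: "nat \<Rightarrow> 'a"
    and V1 V2 V3 :: "'a set"
  assumes "6 \<le> p" and "p \<le> q"
    and "complete_tripartite 3 p q V1 V2 V3 G"
    and "V1 = {x 1, x 2, x 3}"
    and "orientation G D"
    and "strongly_connected (with_proj D)"
    and "diameter (with_proj D) = 2"
    and "card {A. A \<subseteq> {1, 2, 3} \<and> V2 \<inter> N_set (with_proj D) x A \<noteq> {}} = 6"
  shows "q \<le> (p - 2) choose ((p - 2) div 2)"
proof -
  define E where "E = parcs D"
  define t where "t w = {i \<in> {1, 2, 3}. (x i, w) \<in> E}" for w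
  have G: "pverts G = V1 \<union> V2 \<union> V3" "V1 \<inter> V2 = {}" "V1 \<inter> V3 = {}" "V2 \<inter> V3 = {}"
    "card V2 = p" "card V3 = q"
    "parcs G = V1 \<times> V2 \<union> V2 \<times> V1 \<union> V1 \<times> V3 \<union> V3 \<times> V1 \<union> V2 \<times> V3 \<union> V3 \<times> V2"
    using assms(3) by (auto simp: complete_tripartite_def)
  have D: "pverts D = pverts G" "E \<subseteq> parcs G"
    and flip: "\<And>u v. (u, v) \<in> parcs G \<Longrightarrow> (u, v) \<in> E \<longleftrightarrow> (v, u) \<notin> E"
    using assms(5) by (auto simp: orientation_def E_def)
  have fin: "finite V2" "finite V3"
    using G assms(1,2) by (auto intro: card_ge_0_finite)
  have wf: "pair_wf_digraph D"
    using D G by unfold_locales (auto simp: E_def)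
  have walk: "(u, v) \<in> E \<or> (\<exists>z. (u, z) \<in> E \<and> (z, v) \<in> E)"
    if "u \<in> V1 \<union> V2 \<union> V3" "v \<in> V1 \<union> V2 \<union> V3" "u \<noteq> v" for u v
  proof -
    have "directed_dist (with_proj D) u v \<le> diameter (with_proj D)"
      unfolding diameter_def using that D(1) G(1) by (intro SUP_upper2[of "(u, v)"]) auto
    then show ?thesis
      using walk_if_directed_dist_le_2[OF wf _ \<open>u \<noteq> v\<close>] assms(7) by (simp add: E_def)
  qed
  have x: "x i \<in> V1" if "i \<in> {1, 2, 3}" for i
    using that assms(4) by auto
  have V1E: "\<exists>i\<in>{1, 2, 3}. z = x i" if "z \<in> V1" for z
    using that assms(4) by auto
  have in_t: "i \<in> t w \<longleftrightarrow> (x i, w) \<in> E" and notin_t: "i \<notin> t w \<longleftrightarrow> (w, x i) \<in> E"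
    if "i \<in> {1, 2, 3}" "w \<in> V2 \<union> V3" for i w
  proof -
    show "i \<in> t w \<longleftrightarrow> (x i, w) \<in> E"
      using that by (simp add: t_def)
    have "(x i, w) \<in> parcs G"
      using that x G(7) by blast
    with flip show "i \<notin> t w \<longleftrightarrow> (w, x i) \<in> E"
      using that unfolding t_def by blast
  qed
  have "{A. A \<subseteq> {1, 2, 3} \<and> V2 \<inter> N_set (with_proj D) x A \<noteq> {}} = t ` V2"
  proof -
    have "u \<in> N_set (with_proj D) x A \<longleftrightarrow> A = t u" if "u \<in> V2" "A \<subseteq> {1, 2, 3}" for u A
    proof -
      have "u \<in> N_set (with_proj D) x A \<longleftrightarrow>
          (\<forall>i\<in>A. (x i, u) \<in> E) \<and> (\<forall>j\<in>{1, 2, 3} - A. (u, x j) \<in> E)"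
        using that D(1) G(1) by (simp add: N_set_def E_def)
      also have "\<dots> \<longleftrightarrow> (\<forall>i\<in>A. i \<in> t u) \<and> (\<forall>j\<in>{1, 2, 3} - A. j \<notin> t u)"
        by (intro arg_cong2[of _ _ _ _ "(\<and>)"] ball_cong refl in_t[symmetric] notin_t[symmetric])
          (use that in blast)+
      also have "\<dots> \<longleftrightarrow> A = t u"
        using that(2) by (auto simp: t_def)
      finally show ?thesis .
    qed
    moreover have "t u \<subseteq> {1, 2, 3}" for u
      by (auto simp: t_def)
    ultimately show ?thesis
      by blast
  qed
  then have six: "card (t ` V2) = 6"
    using assms(8) by simp
  have parts: "v \<in> V2 \<Longrightarrow> v \<notin> V1 \<and> v \<notin> V3" "v \<in> V3 \<Longrightarrow> v \<notin> V1 \<and> v \<notin> V2" for v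
    using G(2-4) by blast+
  have arcs: "u \<in> V1 \<and> v \<in> V2 \<union> V3 \<or> u \<in> V2 \<and> v \<in> V1 \<union> V3 \<or> u \<in> V3 \<and> v \<in> V1 \<union> V2"
    if "(u, v) \<in> E" for u v
    using that D(2) G(7) by blast
  \<comment> \<open>The way back from \<open>u\<close> to \<open>w\<close> has a middle vertex
    adjacent to both \<open>V2\<close> and \<open>V3\<close>, hence some \<open>x i\<close>; this
    \<open>i\<close> lies in \<open>t w\<close> but not in \<open>t u\<close>.\<close>
  have step: "\<not> t w \<subseteq> t u" if wu: "(w, u) \<in> E" "u \<in> V2 \<and> w \<in> V3 \<or> u \<in> V3 \<and> w \<in> V2" for u w
  proof -
    have "(u, w) \<notin> E" "u \<noteq> w"
      using wu flip[of w u] D(2) parts[of u] by blast+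
    then obtain z where z: "(u, z) \<in> E" "(z, w) \<in> E"
      using walk[of u w] wu by blast
    have "z \<in> V1"
      using arcs[OF z(1)] arcs[OF z(2)] parts[of u] parts[of w] parts[of z] wu by blast
    then obtain i where "i \<in> {1, 2, 3}" "z = x i"
      using V1E by blast
    with z show ?thesis
      using in_t[of i w] notin_t[of i u] wu by blast
  qed
  have "card V3 \<le> central_binomial (card V2 - 2)"
  proof (rule card_le_if_six_colours[where t = t and N = "\<lambda>w. {u. (w, u) \<in> E}"])
    fix u w assume uw: "u \<in> V2" "w \<in> V3"
    then have "(u, w) \<in> parcs G"
      using G(7) by blast
    then have "(u, w) \<in> E \<longleftrightarrow> (w, u) \<notin> E"
      by (rule flip)
    with uw show "t u \<subseteq> t w \<Longrightarrow> u \<in> {u. (w, u) \<in> E}" and "t w \<subseteq> t u \<Longrightarrow> u \<notin> {u. (w, u) \<in> E}"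
      using step[of u w] step[of w u] by blast+
  next
    fix w w' assume ww': "w \<in> V3" "w' \<in> V3" "t w = t w'" "V2 \<inter> {u. (w, u) \<in> E} \<subseteq> {u. (w', u) \<in> E}"
    show "w = w'"
    proof (rule ccontr)
      assume "w \<noteq> w'"
      \<comment> \<open>Two vertices of \<open>V3\<close> need a middle vertex. One in
        \<open>V1\<close> would separate their colours, one in \<open>V2\<close> would violate the
        inclusion of out-neighbourhoods.\<close>
      moreover have "(w, w') \<notin> E"
        using arcs[of w w'] ww'(1,2) parts[of w] parts[of w'] by blast
      ultimately obtain z where z: "(w, z) \<in> E" "(z, w') \<in> E"
        using walk[of w w'] ww'(1,2) by blast
      then consider "z \<in> V1" | "z \<in> V2"
        using ww'(1) arcs[OF z(1)] parts[of w] by blast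
      then show False
      proof cases
        case 1
        then obtain i where "i \<in> {1, 2, 3}" "z = x i"
          using V1E by blast
        with z show False
          using in_t[of i w'] notin_t[of i w] ww'(1-3) by blast
      next
        case 2
        then have "(w', z) \<in> E"
          using z ww'(4) by blast
        with z show False
          using flip[of z w'] D(2) by blast
      qed
    qed
  next
    fix u i assume ui: "u \<in> V2" "i \<in> {1, 2, 3} - t u"
    then have "(u, x i) \<in> E"
      using notin_t by blast
    then have "(x i, u) \<notin> E" "x i \<noteq> u"
      using flip[of u "x i"] D(2) x[of i] ui parts(1)[of u] by auto
    \<comment> \<open>The edge points from \<open>u\<close> to \<open>x i\<close>, so the way back
      passes through a vertex of the third part \<open>V3\<close>.\<close>
    then obtain z where z: "(x i, z) \<in> E" "(z, u) \<in> E"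
      using walk[of "x i" u] x[of i] ui by blast
    moreover have "z \<in> V3"
      using x[of i] ui arcs[OF z(1)] arcs[OF z(2)] parts[of "x i"] parts[of u] parts[of z] by blast
    ultimately show "\<exists>w\<in>V3. i \<in> t w"
      using in_t[of i z] ui by blast
  next
    fix u i assume ui: "u \<in> V2" "i \<in> t u"
    then have i: "i \<in> {1, 2, 3}"
      by (simp add: t_def)
    then have "(x i, u) \<in> E"
      using in_t ui by blast
    then have "(u, x i) \<notin> E" "x i \<noteq> u"
      using flip[of "x i" u] D(2) x[of i] ui i parts(1)[of u] by auto
    then obtain z where z: "(u, z) \<in> E" "(z, x i) \<in> E"
      using walk[of u "x i"] x[of i] ui i by blast
    moreover have "z \<in> V3"
      using x[of i] ui i arcs[OF z(1)] arcs[OF z(2)] parts[of "x i"] parts[of u] parts[of z] by blast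
    ultimately show "\<exists>w\<in>V3. i \<notin> t w"
      using notin_t[of i z] i by blast
  qed (use assms(1) fin six G(5) in \<open>auto simp: t_def\<close>)
  then show ?thesis
    using G by simp
qed

end
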